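(* Let $d\ge 2$. The set $\operatorname{trop}(\mathcal{N}_d)\subset\mathbb{R}^d$ is the double hull of the set of vectors $\{(1,\dots,1),\ (1,2,\dots,d),\ -(1,2,\dots,d)\}$. It is a rational polyhedral cone with the following facet-defining inequalities: $$\operatorname{trop}(\mathcal{N}_d)=\left\{y\in\mathbb{R}^d:\ y_k+y_{k+2}\ge 2y_{k+1}\ (k=1,\dots,d-2),\quad d\,y_{d-1}\ge(d-1)\,y_d\right\}.$$ Moreover, $\operatorname{trop}(\mathcal{N}_d)$ is the Minkowski sum of the linear span of $(1,2,\dots,d)$ and the convex cone with the $d-1$ extremal rays spanned by $(1,0,\dots,0),\ (2,1,0,\dots,0),\ \dots,\ (d-2,d-3,\dots,1,0,0)$ and $(1,\dots,1)$.
   Context: $\mathcal{N}_d\subset\mathbb{R}_{\ge0}^d$ is the closure of $\bigcup_{n\ge1}\{(p_2(x),p_4(x),\dots,p_{2d}(x)):x\in\mathbb{R}^n\}$, where $p_k(x)=x_1^k+\cdots+x_n^k$. For $S\subset\mathbb{R}_{\ge0}^s$, the tropicalization (logarithmic limit set) is $\operatorname{trop}(S)=\lim_{t\to\infty}\log_t(S\cap\mathbb{R}_{>0}^s)$ with $\log_t$ applied coordinatewise; equivalently $y\in\operatorname{trop}(S)$ iff there are sequences $x^{(m)}\in S\cap\mathbb{R}_{>0}^s$ and $\tau_m\in(0,1)$ with $\tau_m\to0$ and $y=\lim_{m\to\infty}\log_{1/\tau_m}(x^{(m)})$. A set $M\subset\mathbb{R}^n$ is max-closed if the coordinatewise maximum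 of any two elements of $M$ lies in $M$. The double hull of a set $S\subset\mathbb{R}^n$ is the smallest closed and max-closed convex cone containing $S$. *)

theory Defs
  imports "HOL-Analysis.Analysis"
begin

text \<open>
  The space \<open>\<real>\<^sup>d\<close> is rendered as \<open>real ^ 'd\<close>. Since the coordinates have to be numbered from
  \<open>1\<close> to \<open>d\<close>, the definitions take a numbering \<open>e\<close> of the index type, to be used with
  \<open>bij_betw e {1..d} UNIV\<close>: the \<open>k\<close>-th coordinate of \<open>y\<close> is \<open>y $ e k\<close>, and
  \<open>vec_of e d f\<close> is the vector \<open>(f 1, \<dots>, f d)\<close>.
\<close>

definition vec_of :: "(nat \<Rightarrow> 'd::finite) \<Rightarrow> nat \<Rightarrow> (nat \<Rightarrow> real) \<Rightarrow> real ^ 'd" where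
  "vec_of e d f = (\<Sum>k = 1..d. f k *\<^sub>R axis (e k) 1)"

text \<open>A point of \<open>\<real>\<^sup>n\<close> is a function of which only the values at \<open>1, \<dots>, n\<close> matter; this lets
  \<open>n\<close> vary in the union below.\<close>

definition power_sum :: "nat \<Rightarrow> nat \<Rightarrow> (nat \<Rightarrow> real) \<Rightarrow> real" where
  "power_sum n k x = (\<Sum>i = 1..n. x i ^ k)"

definition even_power_sums :: "(nat \<Rightarrow> 'd::finite) \<Rightarrow> nat \<Rightarrow> (real ^ 'd) set" where
  "even_power_sums e d =
     closure (\<Union>n\<in>{1..}. {vec_of e d (\<lambda>k. power_sum n (2 * k) x) |x. True})"

definition trop :: "(real ^ 'd::finite) set \<Rightarrow> (real ^ 'd) set" where
  "trop S = {y. \<exists>(x :: nat \<Rightarrow> real ^ 'd) (\<tau> :: nat \<Rightarrow> real).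
     (\<forall>m. x m \<in> S \<and> (\<forall>i. 0 < x m $ i)) \<and>
     (\<forall>m. 0 < \<tau> m \<and> \<tau> m < 1) \<and> \<tau> \<longlonglongrightarrow> 0 \<and>
     (\<lambda>m. \<chi> i. log (1 / \<tau> m) (x m $ i)) \<longlonglongrightarrow> y}"

definition max_closed :: "(real ^ 'd::finite) set \<Rightarrow> bool" where
  "max_closed M \<longleftrightarrow> (\<forall>x\<in>M. \<forall>y\<in>M. (\<chi> i. max (x $ i) (y $ i)) \<in> M)"

text \<open>The closed max-closed convex cones are stable under intersection, so the hull is itself
  the smallest one containing \<open>S\<close>.\<close>

definition double_hull :: "(real ^ 'd::finite) set \<Rightarrow> (real ^ 'd) set" where
  "double_hull S = (\<lambda>M. closed M \<and> max_closed M \<and> convex_cone M) hull S"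

definition rational_polyhedral_cone :: "(real ^ 'd::finite) set \<Rightarrow> bool" where
  "rational_polyhedral_cone C \<longleftrightarrow>
     (\<exists>A. finite A \<and> (\<forall>a\<in>A. \<forall>i. a $ i \<in> \<rat>) \<and> C = {y. \<forall>a\<in>A. 0 \<le> a \<bullet> y})"

text \<open>\<open>conic hull {v}\<close> is the ray \<open>{c *\<^sub>R v | c. 0 \<le> c}\<close>.\<close>

definition extremal_ray_of :: "'a::real_vector set \<Rightarrow> 'a set \<Rightarrow> bool" where
  "extremal_ray_of R K \<longleftrightarrow> (\<exists>v. v \<noteq> 0 \<and> R = conic hull {v}) \<and> R face_of K"

text \<open>The vectors \<open>(j, j - 1, \<dots>, 1, 0, \<dots>, 0)\<close> for \<open>1 \<le> j \<le> d - 2\<close>, and \<open>(1, \<dots>, 1)\<close>.\<close>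

definition ray_generators :: "(nat \<Rightarrow> 'd::finite) \<Rightarrow> nat \<Rightarrow> (real ^ 'd) set" where
  "ray_generators e d =
     (\<lambda>j. vec_of e d (\<lambda>k. if k \<le> j then real (j + 1 - k) else 0)) ` {1..d - 2}
       \<union> {vec_of e d (\<lambda>k. 1)}"

lemma vec_of_nth:
  assumes "bij_betw e {1..d} (UNIV :: 'd::finite set)" "k \<in> {1..d}"
  shows "vec_of e d f $ e k = f k"
proof -
  have "vec_of e d f $ e k = (\<Sum>l = 1..d. if l = k then f l else 0)"
    unfolding vec_of_def sum_component
    by (rule sum.cong) (use assms in \<open>auto simp: axis_def bij_betw_def inj_on_eq_iff\<close>)
  then show ?thesis
    using assms(2) by (simp add: sum.delta)
qed

lemma double_hull_smallest:
  "S \<subseteq> double_hull S"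
  "closed (double_hull S) \<and> max_closed (double_hull S) \<and> convex_cone (double_hull S)"
  "\<lbrakk>S \<subseteq> M; closed M; max_closed M; convex_cone M\<rbrakk> \<Longrightarrow> double_hull S \<subseteq> M"
proof -
  show "S \<subseteq> double_hull S"
    unfolding double_hull_def by (rule hull_subset)
  show "closed (double_hull S) \<and> max_closed (double_hull S) \<and> convex_cone (double_hull S)"
    unfolding double_hull_def
  proof (rule hull_in)
    fix F :: "(real ^ 'a) set set"
    assume F: "Ball F (\<lambda>M. closed M \<and> max_closed M \<and> convex_cone M)"
    then have "convex_cone (\<Inter>F)"
      by (intro convex_cone_Inter) auto
    with F show "closed (\<Inter>F) \<and> max_closed (\<Inter>F) \<and> convex_cone (\<Inter>F)"
      by (auto simp: max_closed_def)
  qed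
  show "\<lbrakk>S \<subseteq> M; closed M; max_closed M; convex_cone M\<rbrakk> \<Longrightarrow> double_hull S \<subseteq> M"
    unfolding double_hull_def by (rule hull_minimal) auto
qed

end

theory Submission
  imports Defs
begin

text \<open>
  Let \<open>L\<^sub>k\<close> be the functional of the \<open>k\<close>-th facet inequality and \<open>g\<^sub>k\<close> the \<open>k\<close>-th ray
  generator. Then \<open>L\<^sub>j g\<^sub>k\<close> is \<open>1\<close> if \<open>j = k\<close> and \<open>0\<close> otherwise, and the common kernel of the
  \<open>L\<^sub>j\<close> is spanned by \<open>v = (1, \<dots>, d)\<close>. So the inequalities cut out the sum of a simplicial cone
  and a line, and facets and extremal rays can be read off. The \<open>j\<close>-th generator other than
  \<open>(1, \<dots>, 1)\<close> is \<open>max (0, (j + 1) (1, \<dots>, 1) - v)\<close>, which gives the double hull.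

  The inequalities hold on the tropicalization by Cauchy-Schwarz and because the \<open>\<ell>\<^sup>p\<close>-norms
  decrease in \<open>p\<close>. Conversely, they say that \<open>y\<close> is convex in \<open>k\<close> and that every line
  \<open>n\<^sub>i + k u\<^sub>i\<close> through two neighbouring values has an intercept \<open>n\<^sub>i \<ge> 0\<close>. Hence taking, for
  every \<open>i\<close>, about \<open>t powr n\<^sub>i\<close> copies of \<open>t powr (u\<^sub>i / 2)\<close> yields a power sum of degree \<open>2 k\<close>
  of the order of \<open>t\<close> to the power \<open>max\<^sub>i (n\<^sub>i + k u\<^sub>i) = y\<^sub>k\<close>.
\<close>

section \<open>Simplicial cones\<close>

text \<open>The \<open>a j\<close> need not span the space, so the cone that they cut out may
  contain a line, whereas the cone generated by the \<open>g k\<close> is pointed. Facets are read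
  off from the former, extremal rays from the latter.\<close>

locale biorthogonal =
  fixes I :: "'i set" and a g :: "'i \<Rightarrow> 'a::euclidean_space"
  assumes finite_index: "finite I"
    and biorth: "\<And>j k. \<lbrakk>j \<in> I; k \<in> I\<rbrakk> \<Longrightarrow> a j \<bullet> g k = (if j = k then 1 else 0)"
begin

lemma inner_sum_gen: "j \<in> I \<Longrightarrow> a j \<bullet> (\<Sum>k\<in>I. c k *\<^sub>R g k) = c j"
  by (simp add: inner_sum_right biorth finite_index if_distrib [of "(*) _"] cong: if_cong)

lemma inj_gen: "inj_on g I"
  by (rule inj_onI) (metis biorth zero_neq_one)

lemma normal_nonzero: "j \<in> I \<Longrightarrow> a j \<noteq> 0"
  using biorth [of j j] by auto

lemma gen_nonzero: "j \<in> I \<Longrightarrow> g j \<noteq> 0"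
  using biorth [of j j] by auto

text \<open>No inequality is redundant: \<open>- g k\<close> violates the \<open>k\<close>-th one
  and satisfies all others. As the cone also has interior points, its facets are given by turning
  one inequality at a time into an equation.\<close>

lemma facets:
  defines "T \<equiv> {y. \<forall>i\<in>I. 0 \<le> a i \<bullet> y}"
  shows "{F. F facet_of T} = (\<lambda>k. {y \<in> T. a k \<bullet> y = 0}) ` I"
proof -
  define H where "H k = {y. (- a k) \<bullet> y \<le> 0}" for k
  have minus_gen: "- g k \<in> H j \<longleftrightarrow> j \<noteq> k" if "j \<in> I" "k \<in> I" for j k
    using that by (simp add: H_def biorth)
  have inj: "inj_on H I"
    by (rule inj_onI) (metis minus_gen)
  \<comment> \<open>\<open>facet_of_polyhedron_explicit\<close> expects a set of halfspaces and a
    normal for each; injectivity of \<open>H\<close> lets the normal be recovered from the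
    halfspace.\<close>
  define b where "b h = - a (inv_into I H h)" for h
  have b: "b (H k) = - a k" if "k \<in> I" for k
    using inv_into_f_f [OF inj that] by (simp add: b_def)
  have T: "T = \<Inter>(H ` I)"
    by (auto simp: T_def H_def)
  \<comment> \<open>The strict inequalities give an open subset of \<open>T\<close>, which is
    nonempty since all functionals are \<open>1\<close> on the sum of the generators.\<close>
  define U where "U = (\<Inter>i\<in>I. {y. 0 < a i \<bullet> y})"
  have "open U"
    unfolding U_def by (intro open_INT finite_index ballI open_halfspace_gt [simplified])
  moreover have "U \<subseteq> T"
    by (auto simp: U_def T_def less_imp_le)
  moreover have "(\<Sum>k\<in>I. 1 *\<^sub>R g k) \<in> U"
    using inner_sum_gen [where c = "\<lambda>_. 1"] by (simp add: U_def)
  ultimately have "interior T \<noteq> {}"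
    using interior_maximal by blast
  then have aff: "affine hull T = UNIV"
    by (rule affine_hull_nonempty_interior)
  have "C facet_of T \<longleftrightarrow> (\<exists>h. h \<in> H ` I \<and> C = T \<inter> {x. b h \<bullet> x = 0})" for C
  proof (rule facet_of_polyhedron_explicit)
    show "finite (H ` I)"
      using finite_index by simp
    show "T = affine hull T \<inter> \<Inter>(H ` I)"
      unfolding aff using T by simp
    show "b h \<noteq> 0 \<and> h = {x. b h \<bullet> x \<le> 0}" if "h \<in> H ` I" for h
      using that by (auto simp: b normal_nonzero) (auto simp: H_def)
    show "T \<subset> affine hull T \<inter> \<Inter>F'" if F': "F' \<subset> H ` I" for F'
    proof -
      obtain k where k: "k \<in> I" "H k \<notin> F'"
        using F' by auto
      have "- g k \<in> \<Inter>F'"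
        using F' k minus_gen by (auto simp: subset_iff image_iff psubset_eq)
      moreover have "- g k \<notin> T"
        using k minus_gen by (auto simp: T)
      moreover have "T \<subseteq> \<Inter>F'"
        using F' unfolding T by blast
      ultimately show ?thesis
        unfolding aff by blast
    qed
  qed
  then show ?thesis
    by (auto simp: b image_iff)
qed

text \<open>By biorthogonality \<open>a i\<close> reads off the coefficient of \<open>g i\<close>.
  The equation forces \<open>y\<close> into the span of the generators; the inequalities alone would
  admit the common kernel of the \<open>a i\<close>.\<close>

lemma mem_convex_cone_hull_gen:
  "y \<in> convex_cone hull (g ` I) \<longleftrightarrow> (\<forall>i\<in>I. 0 \<le> a i \<bullet> y) \<and> y = (\<Sum>i\<in>I. (a i \<bullet> y) *\<^sub>R g i)"
proof
  let ?C = "{y. (\<forall>i\<in>I. 0 \<le> a i \<bullet> y) \<and> y = (\<Sum>i\<in>I. (a i \<bullet> y) *\<^sub>R g i)}"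
  have "convex_cone ?C"
    by (auto simp: convex_cone_iff inner_add_right scaleR_add_left sum.distrib
        simp flip: scaleR_scaleR scaleR_sum_right)
  moreover have "g ` I \<subseteq> ?C"
  proof clarify
    fix k assume k: "k \<in> I"
    have "(\<Sum>i\<in>I. (a i \<bullet> g k) *\<^sub>R g i) = (\<Sum>i\<in>I. if i = k then g i else 0)"
      by (rule sum.cong) (auto simp: biorth k)
    then show "(\<forall>i\<in>I. 0 \<le> a i \<bullet> g k) \<and> g k = (\<Sum>i\<in>I. (a i \<bullet> g k) *\<^sub>R g i)"
      using k finite_index by (simp add: biorth)
  qed
  ultimately show "y \<in> convex_cone hull (g ` I) \<Longrightarrow>
      (\<forall>i\<in>I. 0 \<le> a i \<bullet> y) \<and> y = (\<Sum>i\<in>I. (a i \<bullet> y) *\<^sub>R g i)"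
    using hull_minimal [of "g ` I" ?C convex_cone] by blast
next
  assume y: "(\<forall>i\<in>I. 0 \<le> a i \<bullet> y) \<and> y = (\<Sum>i\<in>I. (a i \<bullet> y) *\<^sub>R g i)"
  have "(\<Sum>i\<in>J. (a i \<bullet> y) *\<^sub>R g i) \<in> convex_cone hull (g ` I)"
    if "finite J" "J \<subseteq> I" for J
    using that
  proof (induction J)
    case empty
    show ?case
      by (simp add: convex_cone_hull_contains_0)
  next
    case (insert i J)
    then have "(a i \<bullet> y) *\<^sub>R g i \<in> convex_cone hull (g ` I)"
      using y by (intro convex_cone_hull_mul hull_inc) auto
    with insert show ?case
      by (auto intro: convex_cone_hull_add)
  qed
  then show "y \<in> convex_cone hull (g ` I)"
    using y finite_index by (metis order_refl)
qed

lemma mem_gen_ray: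
  assumes "k \<in> I"
  shows "y \<in> conic hull {g k} \<longleftrightarrow>
    y \<in> convex_cone hull (g ` I) \<and> (\<forall>i\<in>I - {k}. a i \<bullet> y = 0)"
proof
  assume "y \<in> conic hull {g k}"
  then obtain c where c: "0 \<le> c" "y = c *\<^sub>R g k"
    by (auto simp: conic_hull_explicit)
  then have "y \<in> convex_cone hull (g ` I)"
    using assms by (auto intro!: convex_cone_hull_mul intro: hull_inc)
  then show "y \<in> convex_cone hull (g ` I) \<and> (\<forall>i\<in>I - {k}. a i \<bullet> y = 0)"
    using assms by (auto simp: c biorth)
next
  assume y: "y \<in> convex_cone hull (g ` I) \<and> (\<forall>i\<in>I - {k}. a i \<bullet> y = 0)"
  then have "y = (\<Sum>i\<in>I. (a i \<bullet> y) *\<^sub>R g i)"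
    by (simp add: mem_convex_cone_hull_gen)
  also have "\<dots> = (a k \<bullet> y) *\<^sub>R g k"
    using y assms finite_index by (simp add: sum.remove)
  finally show "y \<in> conic hull {g k}"
    using y assms by (auto simp: conic_hull_explicit mem_convex_cone_hull_gen)
qed

text \<open>If \<open>v\<close> spans an extremal ray and has a positive coefficient
  \<open>c\<close> at \<open>g k\<close>, then \<open>v\<close> is the midpoint of
  \<open>2 c g k\<close> and \<open>2 (v - c g k)\<close>. Both lie in the cone, so the face
  contains the former and must be the ray of \<open>g k\<close>. Conversely, nonnegative
  coefficients that vanish inside a segment vanish at its ends.\<close>

lemma extremal_rays:
  "{R. extremal_ray_of R (convex_cone hull (g ` I))} = (\<lambda>g. conic hull {g}) ` g ` I"
proof (intro equalityI subsetI)
  let ?K = "convex_cone hull (g ` I)"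
  fix R assume "R \<in> {R. extremal_ray_of R ?K}"
  then obtain v where v: "v \<noteq> 0" and R: "R = conic hull {v}" and face: "R face_of ?K"
    by (auto simp: extremal_ray_of_def)
  have vR: "v \<in> R"
    unfolding R by (rule hull_inc) simp
  then have vK: "v \<in> ?K"
    using face face_of_imp_subset by blast
  then have v_eq: "v = (\<Sum>i\<in>I. (a i \<bullet> v) *\<^sub>R g i)" and nonneg: "\<forall>i\<in>I. 0 \<le> a i \<bullet> v"
    by (simp_all add: mem_convex_cone_hull_gen)
  obtain k where k: "k \<in> I" "a k \<bullet> v \<noteq> 0"
    using v v_eq sum.neutral by (metis (no_types, lifting) scaleR_zero_left)
  define c where "c = a k \<bullet> v"
  have c: "0 < c"
    using k nonneg by (force simp: c_def)
  define p where "p = (2 * c) *\<^sub>R g k"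
  define q where "q = 2 *\<^sub>R (v - c *\<^sub>R g k)"
  have pK: "p \<in> ?K"
    using c k by (auto simp: p_def intro!: convex_cone_hull_mul intro: hull_inc)
  have "v - c *\<^sub>R g k \<in> ?K"
    unfolding mem_convex_cone_hull_gen
  proof (intro conjI ballI)
    show "0 \<le> a i \<bullet> (v - c *\<^sub>R g k)" if "i \<in> I" for i
      using that k nonneg by (auto simp: inner_diff_right biorth c_def)
    have "(\<Sum>i\<in>I. (a i \<bullet> (v - c *\<^sub>R g k)) *\<^sub>R g i) =
        (\<Sum>i\<in>I. (a i \<bullet> v) *\<^sub>R g i - (if i = k then c *\<^sub>R g i else 0))"
      by (rule sum.cong) (auto simp: inner_diff_right biorth k algebra_simps)
    also have "\<dots> = v - c *\<^sub>R g k"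
      using v_eq k finite_index by (simp add: sum_subtractf)
    finally show "v - c *\<^sub>R g k = (\<Sum>i\<in>I. (a i \<bullet> (v - c *\<^sub>R g k)) *\<^sub>R g i)"
      by simp
  qed
  then have qK: "q \<in> ?K"
    by (auto simp: q_def intro!: convex_cone_hull_mul)
  have mid: "v = midpoint p q"
    by (simp add: midpoint_def p_def q_def algebra_simps flip: scaleR_add_left)
  have "p \<in> R"
  proof (cases "p = q")
    case True
    then show ?thesis
      using mid vR by simp
  next
    case False
    then have "v \<in> open_segment p q"
      by (simp add: mid midpoint_in_open_segment)
    then show ?thesis
      using face pK qK vR unfolding face_of_def by blast
  qed
  then obtain r where r: "0 \<le> r" "p = r *\<^sub>R v"
    by (auto simp: R conic_hull_explicit)
  have "g k = (1 / (2 * c)) *\<^sub>R p"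
    using c by (simp add: p_def)
  then have "g k = (r / (2 * c)) *\<^sub>R v"
    by (simp add: r(2))
  then have g: "g k \<in> conic hull {v}"
    using r c by (auto simp: conic_hull_explicit)
  \<comment> \<open>Needed to invert the relation: \<open>v\<close> is then also a nonnegative
    multiple of \<open>g k\<close>, so the two rays agree.\<close>
  have "r \<noteq> 0"
    using r c gen_nonzero [OF k(1)] by (auto simp: p_def)
  then have "v = (1 / r) *\<^sub>R p"
    by (simp add: r(2))
  then have "v = ((2 * c) / r) *\<^sub>R g k"
    by (simp add: p_def)
  then have "v \<in> conic hull {g k}"
    using r c by (auto simp: conic_hull_explicit)
  with g have "R = conic hull {g k}"
    unfolding R by (intro equalityI hull_minimal) (auto simp: conic_conic_hull)
  then show "R \<in> (\<lambda>g. conic hull {g}) ` g ` I"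
    using k by blast
next
  let ?K = "convex_cone hull (g ` I)"
  fix R assume "R \<in> (\<lambda>g. conic hull {g}) ` g ` I"
  then obtain k where k: "k \<in> I" and R: "R = conic hull {g k}"
    by auto
  have "R face_of ?K"
    unfolding face_of_def
  proof (intro conjI ballI impI)
    show "R \<subseteq> ?K"
      using R k mem_gen_ray by blast
    show "convex R"
      unfolding R by (simp add: convex_conic_hull)
    fix p q x assume p: "p \<in> ?K" and q: "q \<in> ?K" and x: "x \<in> R" "x \<in> open_segment p q"
    then obtain u where u: "0 < u" "u < 1" "x = (1 - u) *\<^sub>R p + u *\<^sub>R q"
      by (auto simp: in_segment)
    have "a i \<bullet> p = 0 \<and> a i \<bullet> q = 0" if i: "i \<in> I - {k}" for i
    proof -
      have "0 \<le> a i \<bullet> p" "0 \<le> a i \<bullet> q"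
        using p q i by (simp_all add: mem_convex_cone_hull_gen)
      moreover have "(1 - u) * (a i \<bullet> p) + u * (a i \<bullet> q) = 0"
        using x(1) i k by (auto simp: R mem_gen_ray u inner_add_right)
      ultimately show ?thesis
        using u by (simp add: add_nonneg_eq_0_iff)
    qed
    then show "p \<in> R" "q \<in> R"
      using p q k by (auto simp: R mem_gen_ray)
  qed
  then show "R \<in> {R. extremal_ray_of R ?K}"
    using gen_nonzero [OF k] R by (auto simp: extremal_ray_of_def)
qed

lemma inj_gen_ray: "inj_on (\<lambda>g. conic hull {g}) (g ` I)"
proof (rule inj_onI, clarify)
  fix j k assume "j \<in> I" "k \<in> I" and eq: "conic hull {g j} = conic hull {g k}"
  moreover have "g j \<in> conic hull {g j}"
    by (rule hull_inc) simp
  ultimately show "g j = g k"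
    by (metis Diff_iff biorth mem_gen_ray singletonD zero_neq_one)
qed

lemma card_extremal_rays: "card {R. extremal_ray_of R (convex_cone hull (g ` I))} = card I"
  by (simp add: extremal_rays card_image inj_gen_ray inj_gen)

end

section \<open>The cone of the facet inequalities\<close>

locale numbering =
  fixes d :: nat and e :: "nat \<Rightarrow> 'd::finite"
  assumes d: "2 \<le> d" and e: "bij_betw e {1..d} (UNIV :: 'd set)"
begin

section \<open>Normals, generators and the splitting into a line and a pointed cone\<close>

definition normal :: "nat \<Rightarrow> real ^ 'd" where
  "normal k =
     (if k = d - 1 then real d *\<^sub>R axis (e (d - 1)) 1 - (real d - 1) *\<^sub>R axis (e d) 1
      else axis (e k) 1 + axis (e (k + 2)) 1 - 2 *\<^sub>R axis (e (k + 1)) 1)"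

text \<open>The exceptional vector \<open>(1, ..., 1)\<close> is placed at \<open>d - 1\<close>,
  matching the exceptional inequality in \<open>normal\<close>, so that both families share the
  index set \<open>{1..d - 1}\<close>.\<close>

definition gen :: "nat \<Rightarrow> real ^ 'd" where
  "gen k = (if k = d - 1 then vec_of e d (\<lambda>k. 1)
            else vec_of e d (\<lambda>i. if i \<le> k then real (k + 1 - i) else 0))"

abbreviation linear_vec :: "real ^ 'd" where
  "linear_vec \<equiv> vec_of e d real"

definition trop_cone :: "(real ^ 'd) set" where
  "trop_cone = {y. \<forall>k\<in>{1..d - 1}. 0 \<le> normal k \<bullet> y}"

lemmas nth = vec_of_nth [OF e]

lemma vec_eqI: "(\<And>k. k \<in> {1..d} \<Longrightarrow> x $ e k = y $ e k) \<Longrightarrow> x = y"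
  using e unfolding vec_eq_iff bij_betw_def by (metis UNIV_I imageE)

lemma all_index: "(\<forall>i. P i) \<longleftrightarrow> (\<forall>k\<in>{1..d}. P (e k))"
  using e by (metis UNIV_I bij_betw_def imageE)

lemma index_split: "{1..d - 1} = insert (d - 1) {1..d - 2}"
  using d by auto

lemma inner_normal:
  "normal k \<bullet> y = (if k = d - 1 then real d * y $ e (d - 1) - (real d - 1) * y $ e d
     else y $ e k + y $ e (k + 2) - 2 * y $ e (k + 1))"
  by (simp add: normal_def inner_diff_left inner_add_left inner_axis')

lemma trop_cone_eq:
  "trop_cone = {y. (\<forall>k\<in>{1..d - 2}. y $ e k + y $ e (k + 2) \<ge> 2 * y $ e (k + 1))
              \<and> real d * y $ e (d - 1) \<ge> (real d - 1) * y $ e d}"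
  using d by (auto simp: trop_cone_def inner_normal index_split)

lemma normal_linear_vec: "k \<in> {1..d - 1} \<Longrightarrow> normal k \<bullet> linear_vec = 0"
  using d by (auto simp: inner_normal nth of_nat_diff)

lemma gen_nth:
  "i \<in> {1..d} \<Longrightarrow>
    gen k $ e i = (if k = d - 1 then 1 else if i \<le> k then real k + 1 - real i else 0)"
  by (simp add: gen_def nth of_nat_diff)

sublocale biorthogonal "{1..d - 1}" normal gen
proof
  fix j k assume j: "j \<in> {1..d - 1}" and k: "k \<in> {1..d - 1}"
  show "normal j \<bullet> gen k = (if j = k then 1 else 0)"
  proof (cases "j = d - 1")
    case True
    then have "normal j \<bullet> gen k = real d * gen k $ e (d - 1) - (real d - 1) * gen k $ e d"
      by (simp add: inner_normal)
    also have "\<dots> = (if j = k then 1 else 0)"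
      using True k d by (auto simp: gen_nth)
    finally show ?thesis .
  next
    case False
    then have "normal j \<bullet> gen k = gen k $ e j + gen k $ e (j + 2) - 2 * gen k $ e (j + 1)"
      by (simp add: inner_normal)
    also have "\<dots> = (if j = k then 1 else 0)"
    proof -
      have "j \<in> {1..d}" "j + 1 \<in> {1..d}" "j + 2 \<in> {1..d}"
        using False j by auto
      then show ?thesis
        using False by (simp only: gen_nth) auto
    qed
    finally show ?thesis .
  qed
qed simp

lemma gen_image: "gen ` {1..d - 1} = ray_generators e d"
proof -
  have "gen ` {1..d - 2} =
      (\<lambda>j. vec_of e d (\<lambda>k. if k \<le> j then real (j + 1 - k) else 0)) ` {1..d - 2}"
    using d by (intro image_cong) (auto simp: gen_def)
  moreover have "gen (d - 1) = vec_of e d (\<lambda>k. 1)"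
    by (simp add: gen_def)
  ultimately show ?thesis
    unfolding index_split ray_generators_def by simp
qed

text \<open>The condition on the last two entries excludes nonzero multiples of
  \<open>linear_vec\<close>. With it the last normal gives \<open>z $ e d = 0\<close>, and the
  vanishing second differences carry zero downwards.\<close>

lemma common_kernel:
  assumes 0: "\<And>k. k \<in> {1..d - 1} \<Longrightarrow> normal k \<bullet> z = 0" and last: "z $ e (d - 1) = z $ e d"
  shows "z = 0"
proof (rule vec_eqI)
  have d0: "z $ e d = 0"
    using 0 [of "d - 1"] d by (simp add: inner_normal last left_diff_distrib del: One_nat_def)
  \<comment> \<open>Two neighbouring zeros go through the induction, because a second difference
    determines an entry only from the next two.\<close>
  have "z $ e k = 0 \<and> z $ e (k + 1) = 0" if "k \<in> {1..d - 1}" for k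
  proof -
    have "k \<le> d - 1"
      using that by simp
    then show ?thesis
      using that
    proof (induction k rule: inc_induct)
      case base
      then show ?case
        using d d0 last by simp
    next
      case (step n)
      then show ?case
        using 0 [of n] by (simp add: inner_normal)
    qed
  qed
  then show "z $ e k = 0 $ e k" if "k \<in> {1..d}" for k
    using that d0 by (cases "k = d") auto
qed

text \<open>Every generator has equal entries at \<open>d - 1\<close> and \<open>d\<close>, so the
  coefficient of \<open>linear_vec\<close> must be the last increment of \<open>y\<close>. The
  difference of both sides is then killed by all normals and has equal last entries, hence is zero
  by \<open>common_kernel\<close>.\<close>

lemma decomposition:
  "y = (y $ e d - y $ e (d - 1)) *\<^sub>R linear_vec + (\<Sum>k\<in>{1..d - 1}. (normal k \<bullet> y) *\<^sub>R gen k)"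
    (is "y = ?c *\<^sub>R _ + ?s")
proof -
  let ?z = "y - (?c *\<^sub>R linear_vec + ?s)"
  have s: "?s $ e d = ?s $ e (d - 1)"
    unfolding sum_component
    by (rule sum.cong) (use d in \<open>auto simp: gen_def nth\<close>)
  have "linear_vec $ e d = real d" "linear_vec $ e (d - 1) = real d - 1"
    using d by (auto simp: nth of_nat_diff)
  then have last: "?z $ e (d - 1) = ?z $ e d"
    using s by (simp add: right_diff_distrib del: One_nat_def sum_component)
  have "normal k \<bullet> ?z = 0" if "k \<in> {1..d - 1}" for k
    using that by (simp only: inner_diff_right inner_add_right inner_scaleR_right
        normal_linear_vec inner_sum_gen)
  then have "?z = 0"
    using last by (rule common_kernel)
  then show ?thesis
    by simp
qed

lemma trop_cone_eq_sum: "trop_cone = span {linear_vec} + convex_cone hull (ray_generators e d)"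
proof (intro equalityI subsetI)
  fix y assume y: "y \<in> trop_cone"
  let ?s = "\<Sum>k\<in>{1..d - 1}. (normal k \<bullet> y) *\<^sub>R gen k"
  have "?s \<in> convex_cone hull (ray_generators e d)"
    using y unfolding gen_image [symmetric] mem_convex_cone_hull_gen
    by (simp add: inner_sum_gen trop_cone_def del: One_nat_def)
  then show "y \<in> span {linear_vec} + convex_cone hull (ray_generators e d)"
    using decomposition [of y] set_plus_intro span_scale [OF span_base]
    by (metis (no_types, lifting) singletonI)
next
  fix y assume "y \<in> span {linear_vec} + convex_cone hull (ray_generators e d)"
  then obtain c k where "y = c *\<^sub>R linear_vec + k" "k \<in> convex_cone hull (gen ` {1..d - 1})"
    by (auto simp: set_plus_def span_singleton gen_image simp del: One_nat_def)
  then show "y \<in> trop_cone"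
    by (simp add: trop_cone_def inner_add_right normal_linear_vec mem_convex_cone_hull_gen
        del: One_nat_def)
qed

lemma trop_cone_facets:
  "{F. F facet_of trop_cone} =
     (\<lambda>k. {y \<in> trop_cone. y $ e k + y $ e (k + 2) = 2 * y $ e (k + 1)}) ` {1..d - 2}
       \<union> {{y \<in> trop_cone. real d * y $ e (d - 1) = (real d - 1) * y $ e d}}"
proof -
  have "{F. F facet_of trop_cone} = (\<lambda>k. {y \<in> trop_cone. normal k \<bullet> y = 0}) ` {1..d - 1}"
    unfolding trop_cone_def by (rule facets)
  also have "\<dots> = (\<lambda>k. {y \<in> trop_cone. normal k \<bullet> y = 0}) ` {1..d - 2}
      \<union> {{y \<in> trop_cone. normal (d - 1) \<bullet> y = 0}}"
    unfolding index_split by simp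
  also have "(\<lambda>k. {y \<in> trop_cone. normal k \<bullet> y = 0}) ` {1..d - 2} =
      (\<lambda>k. {y \<in> trop_cone. y $ e k + y $ e (k + 2) = 2 * y $ e (k + 1)}) ` {1..d - 2}"
    using d by (intro image_cong) (auto simp: inner_normal)
  finally show ?thesis
    by (simp add: inner_normal)
qed

lemma rational_polyhedral_cone: "rational_polyhedral_cone trop_cone"
  unfolding rational_polyhedral_cone_def
proof (intro exI conjI)
  show "\<forall>a\<in>normal ` {1..d - 1}. \<forall>i. a $ i \<in> \<rat>"
    by (auto simp: normal_def axis_def)
qed (auto simp: trop_cone_def)

section \<open>Closure properties of the cone and the double hull\<close>

lemma closed_trop_cone: "closed trop_cone"
proof -
  have "trop_cone = (\<Inter>k\<in>{1..d - 1}. {y. 0 \<le> normal k \<bullet> y})"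
    by (auto simp: trop_cone_def)
  then show ?thesis
    by (auto intro!: closed_INT closed_halfspace_ge [simplified])
qed

lemma convex_cone_trop_cone: "convex_cone trop_cone"
  by (auto simp: convex_cone_iff trop_cone_def inner_add_right)

text \<open>In each inequality the smaller side is a positive multiple of a single coordinate. Its
  maximum is attained by \<open>x\<close> or by \<open>y\<close>, and the larger side only grows
  when maxima are taken.\<close>

lemma max_closed_trop_cone: "max_closed trop_cone"
  unfolding max_closed_def
proof (intro ballI)
  fix x y assume x: "x \<in> trop_cone" and y: "y \<in> trop_cone"
  have "2 * max (x $ e (k + 1)) (y $ e (k + 1)) \<le>
      max (x $ e k) (y $ e k) + max (x $ e (k + 2)) (y $ e (k + 2))" if "k \<in> {1..d - 2}" for k
  proof -
    have "2 * x $ e (k + 1) \<le> x $ e k + x $ e (k + 2)" "2 * y $ e (k + 1) \<le> y $ e k + y $ e (k + 2)"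
      using that x y by (auto simp: trop_cone_eq)
    then show ?thesis
      by linarith
  qed
  moreover have "(real d - 1) * max (x $ e d) (y $ e d) \<le>
      real d * max (x $ e (d - 1)) (y $ e (d - 1))"
  proof -
    have "real d * x $ e (d - 1) \<le> real d * max (x $ e (d - 1)) (y $ e (d - 1))"
      "real d * y $ e (d - 1) \<le> real d * max (x $ e (d - 1)) (y $ e (d - 1))"
      by (auto intro!: mult_left_mono)
    moreover have "(real d - 1) * x $ e d \<le> real d * x $ e (d - 1)"
      "(real d - 1) * y $ e d \<le> real d * y $ e (d - 1)"
      using x y by (auto simp: trop_cone_eq)
    ultimately show ?thesis
      by (auto simp: max_def)
  qed
  ultimately show "(\<chi> i. max (x $ i) (y $ i)) \<in> trop_cone"
    by (simp add: trop_cone_eq)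
qed

lemma trop_cone_eq_double_hull:
  "trop_cone = double_hull {vec_of e d (\<lambda>k. 1), linear_vec, - linear_vec}"
  (is "_ = double_hull ?S")
proof
  have one: "vec_of e d (\<lambda>k. 1) = gen (d - 1)"
    by (simp add: gen_def)
  have "gen (d - 1) \<in> trop_cone"
    using d by (auto simp: trop_cone_def biorth)
  then have "?S \<subseteq> trop_cone"
    by (auto simp: one) (auto simp: trop_cone_def normal_linear_vec)
  then show "double_hull ?S \<subseteq> trop_cone"
    using closed_trop_cone max_closed_trop_cone convex_cone_trop_cone by (rule double_hull_smallest)
next
  let ?D = "double_hull ?S"
  have S: "?S \<subseteq> ?D" and mc: "max_closed ?D" and cc: "convex_cone ?D"
    using double_hull_smallest [of ?S] by auto
  have "ray_generators e d \<subseteq> ?D"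
    unfolding ray_generators_def
  proof (intro Un_least subsetI)
    show "x \<in> ?D" if "x \<in> {vec_of e d (\<lambda>k. 1)}" for x
      using that S by auto
    fix x assume "x \<in> (\<lambda>j. vec_of e d (\<lambda>k. if k \<le> j then real (j + 1 - k) else 0)) ` {1..d - 2}"
    then obtain j where x: "x = vec_of e d (\<lambda>k. if k \<le> j then real (j + 1 - k) else 0)"
      by auto
    \<comment> \<open>The entries of \<open>?w\<close> are \<open>j + 1 - k\<close>, so replacing
      the negative ones by zero gives \<open>x\<close>.\<close>
    let ?w = "real (j + 1) *\<^sub>R vec_of e d (\<lambda>k. 1) + (- linear_vec)"
    have "x = (\<chi> i. max (0 $ i) (?w $ i))"
      by (rule vec_eqI) (auto simp: x nth of_nat_diff)
    moreover have "0 \<in> ?D"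
      by (rule convex_cone_contains_0 [OF cc])
    moreover have "?w \<in> ?D"
      using S by (intro convex_cone_add convex_cone_scaleR cc) auto
    ultimately show "x \<in> ?D"
      using mc unfolding max_closed_def by blast
  qed
  then have K: "convex_cone hull (ray_generators e d) \<subseteq> ?D"
    using cc by (rule hull_minimal)
  show "trop_cone \<subseteq> ?D"
  proof
    fix y assume "y \<in> trop_cone"
    then obtain c k where y: "y = c *\<^sub>R linear_vec + k"
      and k: "k \<in> convex_cone hull (ray_generators e d)"
      by (auto simp: trop_cone_eq_sum set_plus_def span_singleton)
    have "c *\<^sub>R linear_vec \<in> ?D"
    proof (cases "0 \<le> c")
      case True
      then show ?thesis
        using S by (auto intro!: convex_cone_scaleR cc)
    next
      case False
      then have "(- c) *\<^sub>R (- linear_vec) \<in> ?D"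
        using S by (intro convex_cone_scaleR cc) auto
      then show ?thesis
        by simp
    qed
    then show "y \<in> ?D"
      using k K by (auto simp: y intro!: convex_cone_add cc)
  qed
qed

end

section \<open>Power sums\<close>

text \<open>Cauchy-Schwarz for the entries \<open>x i ^ k\<close> and \<open>x i ^ (k + 2)\<close>;
  only even powers result, so signs do not matter.\<close>

lemma power_sum_log_convex:
  "(power_sum n (2 * (k + 1)) x)\<^sup>2 \<le> power_sum n (2 * k) x * power_sum n (2 * (k + 2)) x"
proof -
  have "(\<Sum>i = 1..n. x i ^ k * x i ^ (k + 2))\<^sup>2 \<le>
      (\<Sum>i = 1..n. (x i ^ k)\<^sup>2) * (\<Sum>i = 1..n. (x i ^ (k + 2))\<^sup>2)"
    by (rule Cauchy_Schwarz_ineq_sum)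
  moreover have "x i ^ k * x i ^ (k + 2) = x i ^ (2 * (k + 1))"
    "(x i ^ k)\<^sup>2 = x i ^ (2 * k)" "(x i ^ (k + 2))\<^sup>2 = x i ^ (2 * (k + 2))" for i
    by (simp_all only: power_add [symmetric] power_mult [symmetric])
      (simp_all add: mult_2 mult_2_right)
  ultimately show ?thesis
    by (simp only: power_sum_def)
qed

text \<open>Comparison of the norms with exponents \<open>m + 1\<close> and \<open>m\<close>, freed
  of roots. Every \<open>a i\<close> is at most the \<open>m\<close>-norm \<open>r\<close>, so one
  factor of \<open>a i ^ Suc m\<close> can be replaced by \<open>r\<close>.\<close>

lemma sum_power_le_power_sum:
  fixes a :: "'a \<Rightarrow> real"
  assumes "finite I" "\<And>i. i \<in> I \<Longrightarrow> 0 \<le> a i" "0 < m"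
  shows "(\<Sum>i\<in>I. a i ^ Suc m) ^ m \<le> (\<Sum>i\<in>I. a i ^ m) ^ Suc m"
proof -
  let ?P = "\<Sum>i\<in>I. a i ^ m"
  define r where "r = root m ?P"
  have P: "0 \<le> ?P"
    using assms by (intro sum_nonneg) auto
  have r: "r ^ m = ?P"
    using assms P by (simp add: r_def real_root_pow_pos2)
  have "a i \<le> r" if "i \<in> I" for i
  proof -
    have "a i ^ m \<le> ?P"
      using that assms by (intro member_le_sum) auto
    then have "root m (a i ^ m) \<le> r"
      unfolding r_def using assms by simp
    then show ?thesis
      using assms that by (simp add: real_root_power_cancel)
  qed
  then have "(\<Sum>i\<in>I. a i ^ Suc m) \<le> r * ?P"
    unfolding sum_distrib_left using assms by (auto intro!: sum_mono mult_right_mono)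
  then have "(\<Sum>i\<in>I. a i ^ Suc m) ^ m \<le> (r * ?P) ^ m"
    using assms by (intro power_mono sum_nonneg) auto
  also have "\<dots> = ?P ^ Suc m"
    by (simp add: power_mult_distrib r)
  finally show ?thesis .
qed

lemma power_sum_norm_mono:
  assumes "2 \<le> d"
  shows "power_sum n (2 * d) x ^ (d - 1) \<le> power_sum n (2 * (d - 1)) x ^ d"
proof -
  have "Suc (d - 1) = d"
    using assms by simp
  then show ?thesis
    using sum_power_le_power_sum [of "{1..n}" "\<lambda>i. (x i)\<^sup>2" "d - 1"] assms
    by (simp add: power_sum_def power_mult)
qed

lemma power_sum_reindex:
  assumes "finite I" "I \<noteq> {}"
  shows "\<exists>n\<ge>1. \<exists>x. \<forall>k. power_sum n k x = (\<Sum>i\<in>I. f i ^ k)"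
proof -
  obtain h where h: "bij_betw h {1..card I} I"
    using ex_bij_betw_nat_finite_1 assms by blast
  have "power_sum (card I) k (f \<circ> h) = (\<Sum>i\<in>I. f i ^ k)" for k
    using sum.reindex_bij_betw [OF h, of "\<lambda>i. f i ^ k"] by (simp add: power_sum_def)
  moreover have "1 \<le> card I"
    using assms by (simp add: Suc_le_eq card_gt_0_iff)
  ultimately show ?thesis
    by blast
qed

text \<open>The value \<open>f i\<close> is repeated \<open>N i\<close> times by indexing with
  pairs; the positive \<open>N i0\<close> ensures that there is at least one entry.\<close>

lemma power_sum_multiplicities:
  assumes "finite I" "i0 \<in> I" "0 < N i0"
  shows "\<exists>n\<ge>1. \<exists>x. \<forall>k. power_sum n k x = (\<Sum>i\<in>I. real (N i) * f i ^ k)"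
proof -
  let ?J = "SIGMA i:I. {..<N i}"
  have "finite ?J" "(i0, 0) \<in> ?J"
    using assms by auto
  then have "\<exists>n\<ge>1. \<exists>x. \<forall>k. power_sum n k x = (\<Sum>p\<in>?J. f (fst p) ^ k)"
    by (intro power_sum_reindex) auto
  moreover have "(\<Sum>p\<in>?J. f (fst p) ^ k) = (\<Sum>i\<in>I. real (N i) * f i ^ k)" for k
    using assms(1) sum.Sigma [of I "\<lambda>i. {..<N i}" "\<lambda>i j. f i ^ k"]
    by (simp add: split_beta)
  ultimately show ?thesis
    by simp
qed

section \<open>The tropicalization\<close>

context numbering
begin

lemma even_power_sums_ineqs:
  assumes "z \<in> even_power_sums e d"
  shows "\<And>k. k \<in> {1..d - 2} \<Longrightarrow> (z $ e (k + 1))\<^sup>2 \<le> z $ e k * z $ e (k + 2)"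
    and "(z $ e d) ^ (d - 1) \<le> (z $ e (d - 1)) ^ d"
proof -
  let ?C = "(\<Inter>k\<in>{1..d - 2}. {z :: real ^ 'd. (z $ e (k + 1))\<^sup>2 \<le> z $ e k * z $ e (k + 2)})
    \<inter> {z. (z $ e d) ^ (d - 1) \<le> (z $ e (d - 1)) ^ d}"
  have "closed ?C"
    by (intro closed_Int closed_INT ballI closed_Collect_le continuous_intros)
  moreover have "(\<Union>n\<in>{1..}. {vec_of e d (\<lambda>k. power_sum n (2 * k) x) |x. True}) \<subseteq> ?C"
    using d power_sum_log_convex power_sum_norm_mono [OF d] by (auto simp: nth)
  ultimately have "even_power_sums e d \<subseteq> ?C"
    unfolding even_power_sums_def by (intro closure_minimal)
  then show "\<And>k. k \<in> {1..d - 2} \<Longrightarrow> (z $ e (k + 1))\<^sup>2 \<le> z $ e k * z $ e (k + 2)"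
    and "(z $ e d) ^ (d - 1) \<le> (z $ e (d - 1)) ^ d"
    using assms by auto
qed

text \<open>Logarithms make the inequalities linear without error term. Thus the approximating
  points already lie in the cone, and its closedness settles the limit.\<close>

lemma log_even_power_sums_in_trop_cone:
  assumes z: "z \<in> even_power_sums e d" and pos: "\<And>i. 0 < z $ i" and b: "1 < b"
  shows "(\<chi> i. log b (z $ i)) \<in> trop_cone"
  unfolding trop_cone_eq
proof (intro CollectI conjI ballI)
  have le: "log b u \<le> log b v" if "0 < u" "u \<le> v" for u v
    using b that by simp
  fix k assume "k \<in> {1..d - 2}"
  then have "log b ((z $ e (k + 1))\<^sup>2) \<le> log b (z $ e k * z $ e (k + 2))"
    using even_power_sums_ineqs [OF z] pos by (intro le) (auto simp: less_imp_neq [symmetric])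
  then show "2 * (\<chi> i. log b (z $ i)) $ e (k + 1) \<le>
      (\<chi> i. log b (z $ i)) $ e k + (\<chi> i. log b (z $ i)) $ e (k + 2)"
    using pos by (simp add: log_nat_power log_mult_pos less_imp_le)
next
  have "log b ((z $ e d) ^ (d - 1)) \<le> log b ((z $ e (d - 1)) ^ d)"
    using even_power_sums_ineqs [OF z] pos b by (simp add: zero_less_power)
  then show "(real d - 1) * (\<chi> i. log b (z $ i)) $ e d \<le> real d * (\<chi> i. log b (z $ i)) $ e (d - 1)"
    using pos d by (simp add: log_nat_power of_nat_diff less_imp_le)
qed

lemma trop_subset_trop_cone: "trop (even_power_sums e d) \<subseteq> trop_cone"
proof
  fix y assume "y \<in> trop (even_power_sums e d)"
  then obtain x :: "nat \<Rightarrow> real ^ 'd" and \<tau> :: "nat \<Rightarrow> real" where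
    x: "\<And>m. x m \<in> even_power_sums e d" "\<And>m i. 0 < x m $ i" and
    \<tau>: "\<And>m. 0 < \<tau> m" "\<And>m. \<tau> m < 1" and
    lim: "(\<lambda>m. \<chi> i. log (1 / \<tau> m) (x m $ i)) \<longlonglongrightarrow> y"
    unfolding trop_def by blast
  have "(\<chi> i. log (1 / \<tau> m) (x m $ i)) \<in> trop_cone" for m
    using x \<tau> by (intro log_even_power_sums_in_trop_cone) auto
  then show "y \<in> trop_cone"
    using closed_sequentially [OF closed_trop_cone _ lim] by blast
qed

section \<open>Realizing a point of the cone by power sums\<close>

definition slope :: "real ^ 'd \<Rightarrow> nat \<Rightarrow> real" where
  "slope y i = y $ e (i + 1) - y $ e i"

text \<open>The value at \<open>0\<close> of the line through the points of \<open>y\<close> at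
  \<open>i\<close> and \<open>i + 1\<close>.\<close>

definition intercept :: "real ^ 'd \<Rightarrow> nat \<Rightarrow> real" where
  "intercept y i = real (i + 1) * y $ e i - real i * y $ e (i + 1)"

text \<open>For \<open>i = d - 1\<close> this is the last facet inequality. Going down from
  \<open>n + 1\<close> to \<open>n\<close> adds \<open>n + 1\<close> times a second difference,
  which is nonnegative.\<close>

lemma intercept_nonneg:
  assumes y: "y \<in> trop_cone" and i: "i \<in> {1..d - 1}"
  shows "0 \<le> intercept y i"
proof -
  have "i \<le> d - 1"
    using i by simp
  then show ?thesis
    using i
  proof (induction i rule: inc_induct)
    case base
    then show ?case
      using y d by (simp add: trop_cone_eq intercept_def of_nat_diff)
  next
    case (step n)
    have "0 \<le> real (n + 1) * (y $ e n + y $ e (n + 2) - 2 * y $ e (n + 1))"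
      using y step.hyps step.prems by (intro mult_nonneg_nonneg) (auto simp: trop_cone_eq)
    moreover have "intercept y n =
        intercept y (Suc n) + real (n + 1) * (y $ e n + y $ e (n + 2) - 2 * y $ e (n + 1))"
      by (simp add: intercept_def algebra_simps)
    ultimately show ?case
      using step by simp
  qed
qed

lemma slope_mono:
  assumes y: "y \<in> trop_cone" and "1 \<le> i" "i \<le> j" "j \<le> d - 1"
  shows "slope y i \<le> slope y j"
  using assms(3,4)
proof (induction j rule: dec_induct)
  case (step n)
  then have "n \<in> {1..d - 2}"
    using assms(2) by auto
  then have "2 * y $ e (n + 1) \<le> y $ e n + y $ e (n + 2)"
    using y by (simp add: trop_cone_eq)
  then have "slope y n \<le> slope y (Suc n)"
    by (simp add: slope_def)
  then show ?case
    using step by simp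
qed simp

text \<open>A convex sequence lies above its chords extended: to the right of \<open>i\<close> its
  increments are at least \<open>slope y i\<close>, to the left at most.\<close>

lemma chord_le:
  assumes y: "y \<in> trop_cone" and i: "i \<in> {1..d - 1}" and k: "k \<in> {1..d}"
  shows "intercept y i + real k * slope y i \<le> y $ e k"
proof (cases "i \<le> k")
  case True
  then show ?thesis
    using k
  proof (induction k rule: dec_induct)
    case base
    show ?case
      by (simp add: intercept_def slope_def algebra_simps)
  next
    case (step n)
    then have "slope y i \<le> slope y n"
      using i by (intro slope_mono y) auto
    then show ?case
      using step i by (simp add: slope_def [of y n] algebra_simps)
  qed
next
  case False
  then have "k \<le> i"
    by simp
  then show ?thesis
    using k
  proof (induction k rule: inc_induct)
    case base
    show ?case
      by (simp add: intercept_def slope_def algebra_simps)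
  next
    case (step n)
    then have "slope y n \<le> slope y i" "Suc n \<in> {1..d}"
      using i by (auto intro!: slope_mono y)
    then show ?case
      using step by (simp add: slope_def [of y n] algebra_simps)
  qed
qed

lemma chord_eq:
  assumes "k \<in> {1..d}"
  shows "\<exists>i\<in>{1..d - 1}. intercept y i + real k * slope y i = y $ e k"
proof (cases "k = d")
  case True
  then show ?thesis
    \<comment> \<open>No chord starts at \<open>d\<close>, so the one ending there is used.\<close>
    using d by (intro bexI [of _ "d - 1"]) (auto simp: intercept_def slope_def of_nat_diff algebra_simps)
next
  case False
  then show ?thesis
    using assms by (intro bexI [of _ k]) (auto simp: intercept_def slope_def algebra_simps)
qed

lemma even_power_sums_near:
  assumes y: "y \<in> trop_cone" and t: "1 < t"
  shows "\<exists>z\<in>even_power_sums e d. \<forall>k\<in>{1..d}.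
    t powr (y $ e k) \<le> z $ e k \<and> z $ e k \<le> 2 * real d * t powr (y $ e k)"
proof -
  let ?I = "{1..d - 1}"
  define N where "N i = nat \<lceil>t powr intercept y i\<rceil>" for i
  \<comment> \<open>The slope is halved because the power sums have degree
    \<open>2 * k\<close>.\<close>
  define f where "f i = t powr (slope y i / 2)" for i
  have N_ge: "t powr intercept y i \<le> N i" for i
    unfolding N_def by linarith
  \<comment> \<open>Rounding up at most doubles a number that is at least \<open>1\<close>. This is
    where nonnegative intercepts are needed, and it yields the factor \<open>2\<close> of the upper
    bound; the factor \<open>d\<close> bounds the number of chords.\<close>
  have N_le: "N i \<le> 2 * t powr intercept y i" if "i \<in> ?I" for i
  proof -
    have "1 \<le> t powr intercept y i"
      using intercept_nonneg [OF y that] t by (simp add: ge_one_powr_ge_zero)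
    then show ?thesis
      unfolding N_def by linarith
  qed
  have f: "f i ^ (2 * k) = t powr (real k * slope y i)" for i k
    using t by (simp add: f_def flip: powr_realpow add: powr_powr algebra_simps)
  have fN: "t powr intercept y i * f i ^ (2 * k) = t powr (intercept y i + real k * slope y i)" for i k
    by (simp add: f powr_add)
  have "0 < t powr intercept y 1"
    using t by simp
  then have "0 < N 1"
    using N_ge [of 1] by linarith
  moreover have "1 \<in> ?I"
    using d by simp
  ultimately obtain n x where n: "1 \<le> n"
    and x: "\<And>k. power_sum n k x = (\<Sum>i\<in>?I. real (N i) * f i ^ k)"
    using power_sum_multiplicities [of ?I 1 N f] by blast
  let ?z = "vec_of e d (\<lambda>k. power_sum n (2 * k) x)"
  have "?z \<in> even_power_sums e d"
    unfolding even_power_sums_def using n by (intro subsetD [OF closure_subset]) auto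
  moreover have "t powr (y $ e k) \<le> ?z $ e k \<and> ?z $ e k \<le> 2 * real d * t powr (y $ e k)"
    if k: "k \<in> {1..d}" for k
  proof
    have z: "?z $ e k = (\<Sum>i\<in>?I. real (N i) * f i ^ (2 * k))"
      using k by (simp add: nth x)
    have nonneg: "0 \<le> f i ^ (2 * k)" for i
      by (simp add: f)
    obtain i where i: "i \<in> ?I" "intercept y i + real k * slope y i = y $ e k"
      using chord_eq [OF k] by blast
    have "t powr (y $ e k) \<le> real (N i) * f i ^ (2 * k)"
      unfolding i(2) [symmetric] fN [symmetric] by (intro mult_right_mono N_ge nonneg)
    also have "\<dots> \<le> (\<Sum>i\<in>?I. real (N i) * f i ^ (2 * k))"
      using i(1) by (intro member_le_sum) (auto intro!: mult_nonneg_nonneg nonneg)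
    finally show "t powr (y $ e k) \<le> ?z $ e k"
      by (simp only: z)
    have "real (N i) * f i ^ (2 * k) \<le> 2 * t powr (y $ e k)" if "i \<in> ?I" for i
    proof -
      have "real (N i) * f i ^ (2 * k) \<le> (2 * t powr intercept y i) * f i ^ (2 * k)"
        by (intro mult_right_mono N_le that nonneg)
      also have "\<dots> \<le> 2 * t powr (y $ e k)"
        using chord_le [OF y that k] t by (simp add: mult.assoc fN)
      finally show ?thesis .
    qed
    then have "?z $ e k \<le> real (card ?I) * (2 * t powr (y $ e k))"
      unfolding z by (rule sum_bounded_above)
    also have "\<dots> \<le> real d * (2 * t powr (y $ e k))"
      by (intro mult_right_mono) auto
    finally show "?z $ e k \<le> 2 * real d * t powr (y $ e k)"
      by simp
  qed
  ultimately show ?thesis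
    by blast
qed

lemma trop_cone_subset_trop: "trop_cone \<subseteq> trop (even_power_sums e d)"
proof
  fix y assume y: "y \<in> trop_cone"
  \<comment> \<open>The shift by \<open>2\<close> keeps \<open>t m\<close> above \<open>1\<close>,
    so that \<open>1 / t m\<close> is an admissible \<open>\<tau>\<close>.\<close>
  define t where "t m = real (m + 2)" for m
  have t: "1 < t m" for m
    by (simp add: t_def)
  obtain x where x: "\<And>m. x m \<in> even_power_sums e d"
    and lower: "\<And>m k. k \<in> {1..d} \<Longrightarrow> t m powr (y $ e k) \<le> x m $ e k"
    and upper: "\<And>m k. k \<in> {1..d} \<Longrightarrow> x m $ e k \<le> 2 * real d * t m powr (y $ e k)"
    using even_power_sums_near [OF y t] by metis
  have pos: "0 < x m $ e k" if "k \<in> {1..d}" for m k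
    using less_le_trans [OF _ lower [OF that]] t [of m] by simp
  have "(\<lambda>m. log (t m) (x m $ e k)) \<longlonglongrightarrow> y $ e k" if k: "k \<in> {1..d}" for k
  proof (rule tendsto_sandwich)
    have "y $ e k \<le> log (t m) (x m $ e k)" for m
      using lower [OF k] t [of m] pos [OF k] by (simp add: le_log_iff)
    then show "\<forall>\<^sub>F m in sequentially. y $ e k \<le> log (t m) (x m $ e k)"
      by simp
    \<comment> \<open>The factor \<open>2 * real d\<close> does not depend on \<open>m\<close>, so
      its logarithm to base \<open>t m\<close> vanishes in the limit.\<close>
    have "log (t m) (x m $ e k) \<le> ln (2 * real d) / ln (t m) + y $ e k" for m
    proof -
      have "log (t m) (x m $ e k) \<le> log (t m) (2 * real d * t m powr (y $ e k))"
        using upper [OF k] t pos [OF k] by (intro log_mono)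
      also have "\<dots> = log (t m) (2 * real d) + y $ e k"
        using t [of m] d by (subst log_mult) auto
      finally show ?thesis
        by (simp add: log_def)
    qed
    then show "\<forall>\<^sub>F m in sequentially.
        log (t m) (x m $ e k) \<le> ln (2 * real d) / ln (t m) + y $ e k"
      by simp
    have "filterlim t at_top sequentially"
      unfolding t_def
      by (intro filterlim_compose [OF filterlim_real_sequentially] filterlim_add_const_nat_at_top)
    then have "filterlim (\<lambda>m. ln (t m)) at_top sequentially"
      by (rule filterlim_compose [OF ln_at_top])
    then have "(\<lambda>m. ln (2 * real d) / ln (t m)) \<longlonglongrightarrow> 0"
      by (rule real_tendsto_divide_at_top [OF tendsto_const])
    then show "(\<lambda>m. ln (2 * real d) / ln (t m) + y $ e k) \<longlonglongrightarrow> y $ e k"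
      using tendsto_add [OF _ tendsto_const] by fastforce
  qed simp
  then have "\<forall>i. (\<lambda>m. log (t m) (x m $ i)) \<longlonglongrightarrow> y $ i"
    unfolding all_index by blast
  then have "(\<lambda>m. \<chi> i. log (1 / (1 / t m)) (x m $ i)) \<longlonglongrightarrow> y"
    by (intro vec_tendstoI) simp
  moreover have "(\<lambda>m. 1 / t m) \<longlonglongrightarrow> 0"
    unfolding t_def using LIMSEQ_ignore_initial_segment [OF lim_1_over_n, of 2] by simp
  moreover have "\<forall>m. 0 < 1 / t m \<and> 1 / t m < 1"
    using t by (auto simp: t_def)
  moreover have "\<forall>i. 0 < x m $ i" for m
    unfolding all_index using pos by blast
  ultimately show "y \<in> trop (even_power_sums e d)"
    unfolding trop_def using x by (intro CollectI exI [of _ x] exI [of _ "\<lambda>m. 1 / t m"] conjI) auto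
qed

lemma trop_even_power_sums: "trop (even_power_sums e d) = trop_cone"
  using trop_subset_trop_cone trop_cone_subset_trop by blast

end

theorem theorem4p5:
  fixes d :: nat and e :: "nat \<Rightarrow> 'd::finite"
  assumes "2 \<le> d" and "bij_betw e {1..d} (UNIV :: 'd set)"
  shows "let T = trop (even_power_sums e d);
             v = vec_of e d (\<lambda>k. real k);
             K = convex_cone hull ray_generators e d
         in T = double_hull {vec_of e d (\<lambda>k. 1), v, - v}
          \<and> rational_polyhedral_cone T
          \<and> T = {y. (\<forall>k\<in>{1..d - 2}. y $ e k + y $ e (k + 2) \<ge> 2 * y $ e (k + 1))
                    \<and> real d * y $ e (d - 1) \<ge> (real d - 1) * y $ e d}
          \<and> {F. F facet_of T} =
              (\<lambda>k. {y \<in> T. y $ e k + y $ e (k + 2) = 2 * y $ e (k + 1)}) ` {1..d - 2}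
                \<union> {{y \<in> T. real d * y $ e (d - 1) = (real d - 1) * y $ e d}}
          \<and> T = span {v} + K
          \<and> {R. extremal_ray_of R K} = (\<lambda>g. conic hull {g}) ` ray_generators e d
          \<and> card {R. extremal_ray_of R K} = d - 1"
proof -
  interpret numbering d e
    using assms by unfold_locales
  show ?thesis
    unfolding Let_def trop_even_power_sums
  proof (intro conjI)
    show "card {R. extremal_ray_of R (convex_cone hull ray_generators e d)} = d - 1"
      using card_extremal_rays by (simp add: gen_image del: One_nat_def)
    show "{R. extremal_ray_of R (convex_cone hull ray_generators e d)} =
        (\<lambda>g. conic hull {g}) ` ray_generators e d"
      using extremal_rays by (simp add: gen_image del: One_nat_def)
  qed (fact trop_cone_eq_double_hull rational_polyhedral_cone trop_cone_eq trop_cone_facets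
      trop_cone_eq_sum)+
qed

end
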